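(* Let $0 < \theta \leq 1$ and let $m$ be a positive integer or $m = \infty$. For integers $t \geq 0$ and (finite) $1 \leq k \leq m$ let $L(t,k) = \log \text{NegOcc}(t|m,k,\theta)$, and define $$L_k = \log\left(1-\theta\cdot\frac{m-k}{m}\right).$$ Then for all integers $t \geq 0$, $$L(t,1) = \log(\theta) + t\log(1-\theta),$$ and for all integers $t \geq 0$ and $k \geq 1$ with $k+1 \leq m$, $$L(t,k+1) = \log\left(\theta\cdot\frac{m-k}{m}\right) + \text{logsumexp}\big(L(t,k),\; L_k + L(t-1,k),\; 2L_k + L(t-2,k),\; \ldots,\; tL_k + L(0,k)\big).$$
   Context: Falling factorials: $(m)_k = \prod_{i=0}^{k-1}(m-i)$. The noncentral Stirling numbers of the second kind are, for integers $n, k \geq 0$ and real $\phi$, $$S(n,k,\phi) = \frac{1}{k!}\sum_{i=0}^{k} \binom{k}{i} (-1)^{k-i} (i+\phi)^n, \qquad 0^0 = 1.$$ For finite $m$, $0 < k \leq m$ and $0 < \theta \leq 1$, the negative occupancy distribution $\text{NegOcc}(m,k,\theta)$ is the distribution on the integers $t \geq 0$ with probability mass function $$\text{NegOcc}(t|m,k,\theta) = \frac{\theta^{k+t}}{m^{k+t}} \cdot (m)_k \cdot S\left(k+t-1, k-1, m\cdot\frac{1-\theta}{\theta}\right).$$ For $m = \infty$ the mass function is understood as the limit as $m \to \infty$, namely the negative binomial mass function $\text{NegOcc}(t|\infty,k,\theta) = \binom{t+k-1}{t}\theta^k(1-\theta)^t$, and $(m-k)/m$ is read as $1$. $\text{logsumexp}(x_0,\ldots,x_t)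 = \log\left(\sum_{r=0}^{t} e^{x_r}\right)$; the argument list in the claim consists of the $t+1$ terms $r L_k + L(t-r,k)$, $r = 0,\ldots,t$. Logarithms take values in $[-\infty,\infty)$ with $\log 0 = -\infty$, $e^{-\infty} = 0$ and $0\cdot(-\infty) = 0$. *)

theory Defs
  imports Complex_Main "HOL-Library.Extended_Nat" "HOL-Library.Extended_Real"
begin

definition falling_factorial :: "real \<Rightarrow> nat \<Rightarrow> real" where
  "falling_factorial x k = (\<Prod>i<k. x - real i)"

definition noncentral_Stirling2 :: "nat \<Rightarrow> nat \<Rightarrow> real \<Rightarrow> real" where
  "noncentral_Stirling2 n k \<phi> =
     (1 / fact k) * (\<Sum>i\<le>k. real (k choose i) * (-1) ^ (k - i) * (real i + \<phi>) ^ n)"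

(* Probability mass function of the negative occupancy distribution at t.  It is meaningful for
   0 < k, enat k \<le> m and 0 < \<theta> \<le> 1.  For m = \<infinity> it is the limit of the finite case,
   i.e. the negative binomial mass function. *)
definition NegOcc :: "enat \<Rightarrow> nat \<Rightarrow> real \<Rightarrow> nat \<Rightarrow> real" where
  "NegOcc m k \<theta> t =
     (case m of
        enat n \<Rightarrow> \<theta> ^ (k + t) / real n ^ (k + t) * falling_factorial (real n) k
                    * noncentral_Stirling2 (k + t - 1) (k - 1) (real n * ((1 - \<theta>) / \<theta>))
      | \<infinity> \<Rightarrow> real ((t + k - 1) choose t) * \<theta> ^ k * (1 - \<theta>) ^ t)"

(* The ratio (m - k) / m, read as 1 for m = \<infinity>. *)
definition unocc_frac :: "enat \<Rightarrow> nat \<Rightarrow> real" where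
  "unocc_frac m k = (case m of enat n \<Rightarrow> (real n - real k) / real n | \<infinity> \<Rightarrow> 1)"

(* Logarithm of a nonnegative real with log 0 = -\<infinity>, and its inverse on [-\<infinity>, \<infinity>).
   The value of ext_exp at \<infinity> is irrelevant, since ext_log never takes that value.
   On ereal, multiplication already satisfies 0 * (-\<infinity>) = 0. *)
definition ext_log :: "real \<Rightarrow> ereal" where
  "ext_log x = (if x = 0 then -\<infinity> else ereal (ln x))"

definition ext_exp :: "ereal \<Rightarrow> real" where
  "ext_exp x = (if x = -\<infinity> then 0 else exp (real_of_ereal x))"

definition logsumexp :: "ereal list \<Rightarrow> ereal" where
  "logsumexp xs = ext_log (\<Sum>x\<leftarrow>xs. ext_exp x)"

definition log_NegOcc :: "enat \<Rightarrow> real \<Rightarrow> nat \<Rightarrow> nat \<Rightarrow> ereal" where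
  "log_NegOcc m \<theta> t k = ext_log (NegOcc m k \<theta> t)"

definition log_fail :: "enat \<Rightarrow> real \<Rightarrow> nat \<Rightarrow> ereal" where
  "log_fail m \<theta> k = ext_log (1 - \<theta> * unocc_frac m k)"

end

theory Submission
  imports Defs
begin

text \<open>
  In multiplicative form the claim says that \<open>NegOcc m (k + 1) \<theta>\<close> is the convolution of
  \<open>NegOcc m k \<theta>\<close> with a geometric distribution of success probability \<open>\<theta> (m - k) / m\<close>.
  The triangular recurrence of the noncentral Stirling numbers (Pascal's rule if \<open>m = \<infinity>\<close>) gives
  a first-order linear recurrence in \<open>t\<close>, whose solution is this convolution.  It also shows that the
  mass function is nonnegative, so that logarithms may be taken term by term.
\<close>

lemma ext_log_mult:
  assumes "0 \<le> x" "0 \<le> y"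
  shows "ext_log (x * y) = ext_log x + ext_log y"
  using assms by (auto simp: ext_log_def ln_mult)

text \<open>For \<open>x = 0\<close> and \<open>n = 0\<close> the convention
  \<open>0 * (-\<infinity>) = 0\<close> of \<open>ereal\<close> matches
  \<open>0 ^ 0 = 1\<close>.\<close>

lemma ext_log_power:
  assumes "0 \<le> x"
  shows "ext_log (x ^ n) = ereal (real n) * ext_log x"
  using assms by (auto simp: ext_log_def ln_realpow zero_ereal_def[symmetric])

lemma ext_exp_ext_log: "0 \<le> x \<Longrightarrow> ext_exp (ext_log x) = x"
  by (auto simp: ext_exp_def ext_log_def)

lemma logsumexp_ext_log:
  assumes "\<And>r. r \<in> set rs \<Longrightarrow> 0 \<le> f r"
  shows "logsumexp (map (\<lambda>r. ext_log (f r)) rs) = ext_log (\<Sum>r\<leftarrow>rs. f r)"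
proof -
  have "map (\<lambda>r. ext_exp (ext_log (f r))) rs = map f rs"
    using assms by (simp add: ext_exp_ext_log)
  then show ?thesis
    \<comment> \<open>\<open>map_eq_conv\<close> would split the list equation into pointwise ones,
      which cannot rewrite the argument of the sum.\<close>
    by (simp add: logsumexp_def comp_def del: map_eq_conv)
qed

lemma noncentral_Stirling2_0_right: "noncentral_Stirling2 n 0 \<phi> = \<phi> ^ n"
  by (simp add: noncentral_Stirling2_def)

text \<open>One factor \<open>real i + \<phi>\<close> is split as
  \<open>(real (Suc k) + \<phi>) - (real (Suc k) - real i)\<close>. The binomial coefficient absorbs
  the second part, which flips the sign and leaves the sum for \<open>k\<close>, with
  \<open>Suc k\<close> cancelling in the factorial.\<close>

lemma noncentral_Stirling2_Suc_Suc:
  "noncentral_Stirling2 (Suc n) (Suc k) \<phi> =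
     noncentral_Stirling2 n k \<phi> + (real (Suc k) + \<phi>) * noncentral_Stirling2 n (Suc k) \<phi>"
proof -
  let ?a = "\<lambda>i. real (Suc k choose i) * (-1) ^ (Suc k - i) * (real i + \<phi>) ^ n"
  let ?b = "\<lambda>i. real (k choose i) * (-1) ^ (k - i) * (real i + \<phi>) ^ n"
  have *: "?a i * (real i + \<phi>) = (real (Suc k) + \<phi>) * ?a i + real (Suc k) * ?b i"
    if "i \<le> k" for i
  proof -
    have "(Suc k - i) * (Suc k choose i) = Suc k * (k choose i)"
      using binomial_absorb_comp[of "Suc k" i] by simp
    then have "real (Suc k - i) * real (Suc k choose i) = real (Suc k) * real (k choose i)"
      by (metis of_nat_mult)
    then have c: "(real (Suc k) - real i) * real (Suc k choose i) = real (Suc k) * real (k choose i)"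
      using that by (simp add: of_nat_diff)
    have s: "(-1 :: real) ^ (Suc k - i) = - ((-1) ^ (k - i))"
      using that by (simp add: Suc_diff_le)
    have "?a i * (real i + \<phi>) = (real (Suc k) + \<phi>) * ?a i
            + ((real (Suc k) - real i) * real (Suc k choose i)) * (-1) ^ (k - i) * (real i + \<phi>) ^ n"
      unfolding s by (simp add: algebra_simps)
    then show ?thesis
      unfolding c by (simp add: mult.assoc)
  qed
  \<comment> \<open>The term \<open>i = Suc k\<close> stands apart: its factor already is
    \<open>real (Suc k) + \<phi>\<close>, so it gives nothing to the sum of
    \<open>?b\<close>.\<close>
  have "(\<Sum>i\<le>Suc k. ?a i * (real i + \<phi>)) =
          (\<Sum>i\<le>k. (real (Suc k) + \<phi>) * ?a i + real (Suc k) * ?b i) + ?a (Suc k) * (real (Suc k) + \<phi>)"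
    using * by simp
  also have "\<dots> = (real (Suc k) + \<phi>) * (\<Sum>i\<le>Suc k. ?a i) + real (Suc k) * (\<Sum>i\<le>k. ?b i)"
    unfolding sum.distrib sum_distrib_left[symmetric] sum.atMost_Suc
    by (simp only: distrib_left mult.commute add.assoc add.commute add.left_commute)
  finally have e: "(\<Sum>i\<le>Suc k. ?a i * (real i + \<phi>)) =
      (real (Suc k) + \<phi>) * (\<Sum>i\<le>Suc k. ?a i) + real (Suc k) * (\<Sum>i\<le>k. ?b i)" .
  have "noncentral_Stirling2 (Suc n) (Suc k) \<phi> =
          1 / fact (Suc k) * (\<Sum>i\<le>Suc k. ?a i * (real i + \<phi>))"
    unfolding noncentral_Stirling2_def power_Suc2 by (simp only: mult.assoc)
  also have "\<dots> = (real (Suc k) + \<phi>) * (1 / fact (Suc k) * (\<Sum>i\<le>Suc k. ?a i))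
                  + real (Suc k) / fact (Suc k) * (\<Sum>i\<le>k. ?b i)"
    unfolding e by (simp only: distrib_left) (simp add: mult.left_commute)
  also have "real (Suc k) / fact (Suc k) = 1 / fact k"
    by simp
  finally show ?thesis
    unfolding noncentral_Stirling2_def by linarith
qed

text \<open>For \<open>n = 0\<close> the sum is the expansion of \<open>(1 - 1) ^ k\<close> with
  \<open>k > 0\<close>; the recurrence carries the zeros to larger \<open>n\<close>.\<close>

lemma noncentral_Stirling2_eq_0: "n < k \<Longrightarrow> noncentral_Stirling2 n k \<phi> = 0"
proof (induction n arbitrary: k)
  case 0
  then have "(\<Sum>i\<le>k. real (k choose i) * (-1) ^ (k - i)) = 0"
    using binomial_ring[of "1::real" "-1" k] by (simp add: zero_power)
  then show ?case
    by (simp add: noncentral_Stirling2_def)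
next
  case (Suc n)
  then obtain j where "k = Suc j" "n < j"
    by (cases k) auto
  then show ?case
    using Suc.IH by (simp add: noncentral_Stirling2_Suc_Suc)
qed

text \<open>In the finite case the Stirling number is a pure power of
  \<open>n * (1 - \<theta>) / \<theta>\<close>, which cancels all of \<open>n\<close> and all but
  one factor \<open>\<theta>\<close>.\<close>

lemma NegOcc_1:
  assumes "0 < m" "0 < \<theta>"
  shows "NegOcc m 1 \<theta> t = \<theta> * (1 - \<theta>) ^ t"
proof (cases m)
  case (enat n)
  then have "n \<noteq> 0"
    using assms(1) by (auto simp: zero_enat_def)
  then show ?thesis
    using enat assms(2)
    by (simp add: NegOcc_def falling_factorial_def noncentral_Stirling2_0_right
        power_mult_distrib power_divide)
next
  case infinity
  then show ?thesis
    by (simp add: NegOcc_def)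
qed

text \<open>The diagonal Stirling numbers for \<open>k\<close> and \<open>k - 1\<close> agree, so
  only the prefactors contribute to the ratio.\<close>

lemma NegOcc_0_Suc:
  assumes "1 \<le> k"
  shows "NegOcc m (Suc k) \<theta> 0 = \<theta> * unocc_frac m k * NegOcc m k \<theta> 0"
proof (cases m)
  case (enat n)
  obtain j where j: "k = Suc j"
    using assms by (cases k) auto
  have "noncentral_Stirling2 k k \<phi> = noncentral_Stirling2 j j \<phi>" for \<phi>
    by (simp add: j noncentral_Stirling2_Suc_Suc noncentral_Stirling2_eq_0)
  then show ?thesis
    by (simp add: enat NegOcc_def unocc_frac_def falling_factorial_def j)
next
  case infinity
  then show ?thesis
    by (simp add: NegOcc_def unocc_frac_def)
qed

lemma NegOcc_Suc_Suc:
  assumes "0 < m" "\<theta> \<noteq> 0" "1 \<le> k"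
  shows "NegOcc m (Suc k) \<theta> (Suc t) =
     \<theta> * unocc_frac m k * NegOcc m k \<theta> (Suc t)
     + (1 - \<theta> * unocc_frac m k) * NegOcc m (Suc k) \<theta> t"
proof (cases m)
  case (enat n)
  then have n: "real n \<noteq> 0"
    using assms(1) by (auto simp: zero_enat_def)
  obtain j where j: "k = Suc j"
    using assms(3) by (cases k) auto
  define \<phi> where "\<phi> = real n * ((1 - \<theta>) / \<theta>)"
  define F where "F = falling_factorial (real n) k"
  define c where "c = \<theta> / real n"
  \<comment> \<open>The recurrence leads to exactly the index pairs that occur in
    \<open>NegOcc m k \<theta> (Suc t)\<close> (for \<open>A\<close>) and
    \<open>NegOcc m (Suc k) \<theta> t\<close> (for \<open>B\<close>).\<close>
  define A where "A = noncentral_Stirling2 (k + t) j \<phi>"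
  define B where "B = noncentral_Stirling2 (k + t) k \<phi>"
  have F: "falling_factorial (real n) (Suc k) = F * (real n - real k)"
    by (simp add: F_def falling_factorial_def)
  have "noncentral_Stirling2 (Suc (k + t)) k \<phi> = A + (real k + \<phi>) * B"
    by (simp add: A_def B_def j noncentral_Stirling2_Suc_Suc)
  then have 1: "NegOcc m (Suc k) \<theta> (Suc t) =
      c ^ (k + t + 2) * (F * (real n - real k)) * (A + (real k + \<phi>) * B)"
    by (simp add: enat NegOcc_def F \<phi>_def c_def power_divide)
  have 2: "NegOcc m (Suc k) \<theta> t = c ^ (k + t + 1) * (F * (real n - real k)) * B"
    by (simp add: enat NegOcc_def F \<phi>_def c_def power_divide B_def)
  have 3: "NegOcc m k \<theta> (Suc t) = c ^ (k + t + 1) * F * A"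
    by (simp add: enat NegOcc_def F_def \<phi>_def c_def power_divide A_def j)
  have u: "\<theta> * unocc_frac m k = c * (real n - real k)"
    by (simp add: enat unocc_frac_def c_def)
  \<comment> \<open>Since \<open>c * \<phi> = 1 - \<theta>\<close>, the Stirling weight
    \<open>real k + \<phi>\<close> turns into the failure probability.\<close>
  have f: "1 - \<theta> * unocc_frac m k = c * (real k + \<phi>)"
    using n assms(2) by (simp add: enat unocc_frac_def c_def \<phi>_def field_simps)
  show ?thesis
    unfolding 1 2 3 f unfolding u by (simp add: algebra_simps)
next
  case infinity
  have "(t + k) choose (Suc t) = ((t + k - 1) choose t) + ((t + k - 1) choose (Suc t))"
    using assms(3) by (cases k) auto
  then show ?thesis
    using infinity by (simp add: NegOcc_def unocc_frac_def algebra_simps)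
qed

text \<open>Unrolling: the input \<open>y (t - r)\<close> passes through \<open>r\<close> further
  steps and gains a factor \<open>b\<close> in each.\<close>

lemma linear_recurrence_solution:
  fixes x y :: "nat \<Rightarrow> 'a::comm_semiring_1"
  assumes "x 0 = a * y 0" "\<And>t. x (Suc t) = a * y (Suc t) + b * x t"
  shows "x t = a * (\<Sum>r\<le>t. b ^ r * y (t - r))"
proof (induction t)
  case 0
  then show ?case
    using assms(1) by simp
next
  case (Suc t)
  have "(\<Sum>r\<le>Suc t. b ^ r * y (Suc t - r)) = y (Suc t) + b * (\<Sum>r\<le>t. b ^ r * y (t - r))"
    unfolding sum.atMost_Suc_shift sum_distrib_left by (simp add: mult.assoc)
  then show ?case
    using Suc assms(2)[of t] by (simp add: algebra_simps)
qed

lemma NegOcc_Suc_eq_convolution: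
  assumes "0 < m" "\<theta> \<noteq> 0" "1 \<le> k"
  shows "NegOcc m (Suc k) \<theta> t =
     \<theta> * unocc_frac m k * (\<Sum>r\<le>t. (1 - \<theta> * unocc_frac m k) ^ r * NegOcc m k \<theta> (t - r))"
  using NegOcc_0_Suc[OF assms(3)] NegOcc_Suc_Suc[OF assms]
  by (rule linear_recurrence_solution)

lemma unocc_frac_bounds:
  assumes "enat k \<le> m"
  shows "0 \<le> unocc_frac m k" "unocc_frac m k \<le> 1"
  using assms by (auto simp: unocc_frac_def divide_simps split: enat.splits)

lemma fail_prob_nonneg:
  assumes "0 < \<theta>" "\<theta> \<le> 1" "enat k \<le> m"
  shows "0 \<le> 1 - \<theta> * unocc_frac m k"
  using mult_mono[of \<theta> 1 "unocc_frac m k" 1] unocc_frac_bounds[OF assms(3)] assms by simp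

text \<open>The alternating sum hides the sign. Induction on \<open>k\<close> shows it: a geometric
  mass function at \<open>k = 1\<close>, then convolutions with nonnegative weights.\<close>

lemma NegOcc_nonneg:
  assumes "0 < m" "0 < \<theta>" "\<theta> \<le> 1" "1 \<le> k" "enat k \<le> m"
  shows "0 \<le> NegOcc m k \<theta> t"
  using assms(4,5)
proof (induction k arbitrary: t rule: dec_induct)
  case base
  then show ?case
    using assms by (simp add: NegOcc_1[unfolded One_nat_def])
next
  case (step k)
  have k: "enat k \<le> m"
    using step.prems by (meson enat_ord_simps(1) le_SucI order_refl order_trans)
  show ?case
    unfolding NegOcc_Suc_eq_convolution[OF assms(1) less_imp_neq[OF assms(2), symmetric] step.hyps(1)]
    using step.IH k assms(2) unocc_frac_bounds(1)[OF k] fail_prob_nonneg[OF assms(2,3) k]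
    by (intro mult_nonneg_nonneg sum_nonneg zero_le_power) auto
qed

theorem theorem7:
  fixes m :: enat and \<theta> :: real
  assumes "0 < m" and "0 < \<theta>" and "\<theta> \<le> 1"
  shows "(\<forall>t::nat. log_NegOcc m \<theta> t 1 = ext_log \<theta> + ereal (real t) * ext_log (1 - \<theta>)) \<and>
         (\<forall>(t::nat) (k::nat). 1 \<le> k \<and> enat (k + 1) \<le> m \<longrightarrow>
            log_NegOcc m \<theta> t (k + 1) =
              ext_log (\<theta> * unocc_frac m k)
              + logsumexp (map (\<lambda>r. ereal (real r) * log_fail m \<theta> k + log_NegOcc m \<theta> (t - r) k)
                               [0..<t + 1]))"
proof (intro conjI allI impI)
  fix t
  show "log_NegOcc m \<theta> t 1 = ext_log \<theta> + ereal (real t) * ext_log (1 - \<theta>)"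
    using assms NegOcc_1[of m \<theta> t] unfolding log_NegOcc_def
    by (simp add: ext_log_mult ext_log_power)
next
  fix t k :: nat
  assume "1 \<le> k \<and> enat (k + 1) \<le> m"
  then have k: "1 \<le> k" and km: "enat k \<le> m"
    by (auto intro: order_trans[of _ "enat (k + 1)"])
  define f where "f = 1 - \<theta> * unocc_frac m k"
  have f: "0 \<le> f"
    unfolding f_def using assms(2,3) km by (rule fail_prob_nonneg)
  have N: "0 \<le> NegOcc m k \<theta> s" for s
    using assms k km by (rule NegOcc_nonneg)
  have u: "0 \<le> \<theta> * unocc_frac m k"
    using assms(2) unocc_frac_bounds(1)[OF km] by simp
  \<comment> \<open>If \<open>f = 0\<close> (\<open>\<theta> = 1\<close> and
    \<open>m = \<infinity>\<close>), the entry for \<open>r = 0\<close> survives because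
    \<open>0 * (-\<infinity>) = 0\<close>, and all others are \<open>-\<infinity>\<close>.\<close>
  have entry: "ereal (real r) * log_fail m \<theta> k + log_NegOcc m \<theta> (t - r) k =
      ext_log (f ^ r * NegOcc m k \<theta> (t - r))" for r
    using f N by (simp add: log_fail_def log_NegOcc_def f_def ext_log_mult ext_log_power)
  \<comment> \<open>The sum over \<open>r \<le> t\<close> becomes a sum over a list, as
    \<open>logsumexp\<close> requires; without \<open>upt_Suc\<close> the list
    \<open>[0..<t + 1]\<close> stays in one piece.\<close>
  have "NegOcc m (k + 1) \<theta> t =
      \<theta> * unocc_frac m k * (\<Sum>r\<leftarrow>[0..<t + 1]. f ^ r * NegOcc m k \<theta> (t - r))"
    using NegOcc_Suc_eq_convolution[of m \<theta> k t] assms k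
    by (simp add: f_def interv_sum_list_conv_sum_set_nat atLeast0AtMost[symmetric]
        atLeastLessThanSuc_atLeastAtMost del: upt_Suc)
  \<comment> \<open>\<open>ext_log_mult\<close> requires both factors to be nonnegative.\<close>
  moreover have "0 \<le> (\<Sum>r\<leftarrow>[0..<t + 1]. f ^ r * NegOcc m k \<theta> (t - r))"
    using f N by (intro sum_list_nonneg) auto
  ultimately show "log_NegOcc m \<theta> t (k + 1) = ext_log (\<theta> * unocc_frac m k)
      + logsumexp (map (\<lambda>r. ereal (real r) * log_fail m \<theta> k + log_NegOcc m \<theta> (t - r) k) [0..<t + 1])"
    unfolding entry using u f N
    by (simp add: log_NegOcc_def ext_log_mult[OF u] logsumexp_ext_log del: upt_Suc)
qed

end
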